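(* Let $T(X)=\sum_i V_i^*XV_i$ be a completely positive map on $M_d$ (acting on $H=\mathbb{C}^d$) with $T(I)\le I$ and finite stabilization index, and let $Q$ be its orbit-support projection. Then $T$ is corner-faithful if and only if \[ QH\cap\bigcap_i\ker(V_i^* )=\{0\}, \] equivalently, for every $0\ne v\in QH$ there exists $i$ with $V_i^*v\ne0$.
   Context: $d(T)=I-T(I)$; the stabilization index is $n_T=\min\{n\ge1: T^n(d(T))=0\}$. For positive semidefinite $x$, $\mathrm{supp}(x)$ is the orthogonal projection onto the range of $x$. The orbit-support projection is $Q=\bigvee_{k<n_T}\mathrm{supp}(T^k(d(T)))$. $T$ is corner-faithful if every $x\ge0$, $x\ne0$ with $\mathrm{supp}(x)\le Q$ satisfies $T(x)\ne0$. *)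

theory Defs
  imports "HOL-Analysis.Analysis"
begin

text \<open>Matrices in M_d(C) are modelled as complex^'n^'n with d = CARD('n);
  H = C^d is complex^'n.\<close>

definition cadj :: "complex^'n^'m \<Rightarrow> complex^'m^'n" where
  "cadj A = (\<chi> i j. cnj (A $ j $ i))"

text \<open>Hermitian form <v, A v> = sum_i conj(v_i) (A v)_i.\<close>
definition qform :: "complex^'n^'n \<Rightarrow> complex^'n \<Rightarrow> complex" where
  "qform A v = (\<Sum>i\<in>UNIV. cnj (v $ i) * (A *v v) $ i)"

text \<open>Positive semidefinite: <v, A v> >= 0 for all v (over C this forces A hermitian).\<close>
definition psd :: "complex^'n^'n \<Rightarrow> bool" where
  "psd A \<longleftrightarrow> (\<forall>v. Im (qform A v) = 0 \<and> Re (qform A v) \<ge> 0)"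

text \<open>Loewner order A <= B.\<close>
definition loewner_le :: "complex^'n^'n \<Rightarrow> complex^'n^'n \<Rightarrow> bool" where
  "loewner_le A B \<longleftrightarrow> psd (B - A)"

definition orth_proj :: "complex^'n^'n \<Rightarrow> bool" where
  "orth_proj P \<longleftrightarrow> P ** P = P \<and> cadj P = P"

text \<open>The orthogonal projection onto a subspace W.\<close>
definition proj_onto :: "(complex^'n) set \<Rightarrow> complex^'n^'n" where
  "proj_onto W = (THE P. orth_proj P \<and> range ((*v) P) = W)"

text \<open>Support projection: orthogonal projection onto the range of x.\<close>
definition supp :: "complex^'n^'n \<Rightarrow> complex^'n^'n" where
  "supp x = proj_onto (range ((*v) x))"

text \<open>Join of the projections supp(M k), k < n: the projection onto the
  (closed) linear span of their ranges, i.e. onto the sum of the subspaces.\<close>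
definition supp_join :: "nat \<Rightarrow> (nat \<Rightarrow> complex^'n^'n) \<Rightarrow> complex^'n^'n" where
  "supp_join n M = proj_onto {(\<Sum>k<n. u k) | u. \<forall>k<n. u k \<in> range ((*v) (supp (M k)))}"

definition defect :: "(complex^'n^'n \<Rightarrow> complex^'n^'n) \<Rightarrow> complex^'n^'n" where
  "defect T = mat 1 - T (mat 1)"

definition stab_index :: "(complex^'n^'n \<Rightarrow> complex^'n^'n) \<Rightarrow> nat" where
  "stab_index T = (LEAST n. n \<ge> 1 \<and> (T ^^ n) (defect T) = 0)"

definition orbit_supp :: "(complex^'n^'n \<Rightarrow> complex^'n^'n) \<Rightarrow> complex^'n^'n" where
  "orbit_supp T = supp_join (stab_index T) (\<lambda>k. (T ^^ k) (defect T))"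

definition corner_faithful :: "(complex^'n^'n \<Rightarrow> complex^'n^'n) \<Rightarrow> bool" where
  "corner_faithful T \<longleftrightarrow>
     (\<forall>x. psd x \<and> x \<noteq> 0 \<and> loewner_le (supp x) (orbit_supp T) \<longrightarrow> T x \<noteq> 0)"

end

theory Submission
  imports Defs
begin

text \<open>For positive semidefinite \<open>x\<close> one has
  \<open>\<langle>w, T(x) w\<rangle> = (\<Sum>i. \<langle>V\<^sub>i w, x V\<^sub>i w\<rangle>)\<close>, a sum of nonnegative terms; so \<open>T(x) = 0\<close>
  forces \<open>x V\<^sub>i = 0\<close>, i.e. \<open>V\<^sub>i\<^sup>* x = 0\<close>, for every \<open>i\<close>. Hence every vector in the range
  of \<open>x\<close>, which lies in \<open>QH\<close> when \<open>supp x \<le> Q\<close>, is killed by all \<open>V\<^sub>i\<^sup>*\<close>. Conversely,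
  a nonzero \<open>v \<in> QH\<close> killed by all \<open>V\<^sub>i\<^sup>*\<close> yields the rank-one witness
  \<open>x = v v\<^sup>*\<close> with \<open>T(x) = 0\<close>.\<close>

section \<open>Complex inner product and adjoint\<close>

definition cinner :: "complex^'n \<Rightarrow> complex^'n \<Rightarrow> complex" where
  "cinner x y = (\<Sum>i\<in>UNIV. cnj (x $ i) * y $ i)"

lemma qform_cinner: "qform A v = cinner v (A *v v)"
  by (simp add: qform_def cinner_def)

lemma cinner_add_left: "cinner (x + y) z = cinner x z + cinner y z"
  by (simp add: cinner_def distrib_right sum.distrib)

lemma cinner_add_right: "cinner x (y + z) = cinner x y + cinner x z"
  by (simp add: cinner_def distrib_left sum.distrib)

lemma cinner_diff_left: "cinner (x - y) z = cinner x z - cinner y z"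
  by (simp add: cinner_def left_diff_distrib sum_subtractf)

lemma cinner_diff_right: "cinner x (y - z) = cinner x y - cinner x z"
  by (simp add: cinner_def right_diff_distrib sum_subtractf)

lemma cinner_scale_left: "cinner (c *s x) y = cnj c * cinner x y"
  by (simp add: cinner_def sum_distrib_left algebra_simps)

lemma cinner_scale_right: "cinner x (c *s y) = c * cinner x y"
  by (simp add: cinner_def sum_distrib_left algebra_simps)

lemma cinner_zero_left [simp]: "cinner 0 x = 0"
  and cinner_zero_right [simp]: "cinner x 0 = 0"
  by (simp_all add: cinner_def)

lemma cinner_commute: "cinner y x = cnj (cinner x y)"
  by (simp add: cinner_def mult.commute)

lemma cinner_self: "cinner x x = of_real ((norm x)\<^sup>2)"
proof -
  have "cinner x x = of_real (\<Sum>i\<in>UNIV. (cmod (x $ i))\<^sup>2)"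
    unfolding cinner_def of_real_sum complex_norm_square by (simp add: mult.commute)
  also have "\<dots> = of_real ((norm x)\<^sup>2)"
    by (simp add: norm_vec_def L2_set_def sum_nonneg)
  finally show ?thesis .
qed

lemma cinner_self_eq_0 [simp]: "cinner x x = 0 \<longleftrightarrow> x = 0"
  by (simp add: cinner_self)

lemma cinner_eqI: "(\<And>z. cinner x z = cinner y z) \<Longrightarrow> x = y"
  by (metis cinner_diff_left cinner_self_eq_0 eq_iff_diff_eq_0)

lemma cinner_adj: "cinner w (A *v y) = cinner (cadj A *v w) y"
proof -
  have "cinner w (A *v y) = (\<Sum>i\<in>UNIV. \<Sum>j\<in>UNIV. cnj (w$i) * (A$i$j * y$j))"
    by (simp add: cinner_def matrix_vector_mult_def sum_distrib_left)
  also have "\<dots> = (\<Sum>j\<in>UNIV. \<Sum>i\<in>UNIV. cnj (w$i) * (A$i$j * y$j))"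
    by (rule sum.swap)
  also have "\<dots> = cinner (cadj A *v w) y"
    by (simp add: cinner_def matrix_vector_mult_def cadj_def sum_distrib_right sum_distrib_left mult_ac)
  finally show ?thesis .
qed

lemma Re_cinner: "Re (cinner x y) = inner x y"
  by (simp add: inner_vec_def cinner_def inner_complex_def)

lemma cadj_mult: "cadj (A ** B) = cadj B ** cadj A"
  by (simp add: cadj_def matrix_matrix_mult_def vec_eq_iff mult.commute)

lemma cadj_cadj [simp]: "cadj (cadj A) = A"
  by (simp add: cadj_def vec_eq_iff)

lemma cadj_zero [simp]: "cadj 0 = 0"
  by (simp add: cadj_def vec_eq_iff)

lemma cadj_eq_iff_cinner: "cadj A = B \<longleftrightarrow> (\<forall>x y. cinner (A *v x) y = cinner x (B *v y))"
  by (metis cinner_adj cinner_eqI cadj_cadj matrix_eq)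

section \<open>Orthogonal projections\<close>

lemma vec_subspace_range: "vec.subspace (range ((*v) A))"
  by (rule vec.subspace_image[OF vec.subspace_UNIV])

lemma orth_proj_fix: "orth_proj P \<Longrightarrow> u \<in> range ((*v) P) \<Longrightarrow> P *v u = u"
  unfolding orth_proj_def by (auto simp: matrix_vector_mul_assoc)

lemma orth_proj_mult_left:
  assumes "orth_proj P" and "range ((*v) A) \<subseteq> range ((*v) P)"
  shows "P ** A = A"
proof -
  have "P *v (A *v x) = A *v x" for x
    using assms by (blast intro: orth_proj_fix)
  then show ?thesis
    by (simp add: matrix_eq matrix_vector_mul_assoc[symmetric])
qed

lemma orth_proj_mult_right:
  assumes "orth_proj P" and "orth_proj A" and "range ((*v) A) \<subseteq> range ((*v) P)"
  shows "A ** P = A"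
proof -
  have "A ** P = cadj (P ** A)"
    using assms(1,2) by (simp add: cadj_mult orth_proj_def)
  also have "\<dots> = cadj A"
    using assms by (simp add: orth_proj_mult_left)
  finally show ?thesis
    using assms(2) by (simp add: orth_proj_def)
qed

lemma orth_proj_unique:
  assumes "orth_proj P" and "orth_proj P'" and "range ((*v) P) = range ((*v) P')"
  shows "P = P'"
proof -
  have "P = P' ** P"
    using assms by (simp add: orth_proj_mult_left)
  also have "\<dots> = P'"
    using assms by (simp add: orth_proj_mult_right)
  finally show ?thesis .
qed

lemma orth_proj_cinner: "orth_proj P \<Longrightarrow> cinner (P *v x) y = cinner x (P *v y)"
  unfolding orth_proj_def by (simp add: cinner_adj)

lemma qform_orth_proj:
  assumes "orth_proj P"
  shows "qform P v = cinner (P *v v) (P *v v)"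
proof -
  have "qform P v = cinner v (P *v (P *v v))"
    using assms by (simp add: qform_cinner orth_proj_def matrix_vector_mul_assoc)
  also have "\<dots> = cinner (P *v v) (P *v v)"
    using assms by (simp add: cinner_adj orth_proj_def)
  finally show ?thesis .
qed

lemma orth_proj_pythagoras:
  assumes "orth_proj P"
  shows "cinner v v = cinner (P *v v) (P *v v) + cinner (v - P *v v) (v - P *v v)"
proof -
  have "P *v (v - P *v v) = 0"
    using assms by (simp add: orth_proj_def matrix_vector_mult_diff_distrib matrix_vector_mul_assoc)
  then have cross: "cinner (P *v v) (v - P *v v) = 0"
    using orth_proj_cinner[OF assms] by simp
  have "cinner v v = cinner (P *v v + (v - P *v v)) (P *v v + (v - P *v v))"
    by simp
  also have "\<dots> = cinner (P *v v) (P *v v) + cinner (v - P *v v) (v - P *v v)"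
    using cross cinner_commute[of "P *v v" "v - P *v v"]
    by (simp only: cinner_add_left cinner_add_right) simp
  finally show ?thesis .
qed

lemma subspace_if_vec_subspace:
  fixes W :: "(complex^'n) set"
  assumes "vec.subspace W"
  shows "subspace W"
proof -
  have "c *\<^sub>R x = complex_of_real c *s x" for c and x :: "complex^'n"
    by (simp add: vec_eq_iff) (simp add: scaleR_conv_of_real)
  then show ?thesis
    using assms unfolding subspace_def vec.subspace_def by metis
qed

lemma orthogonal_decomp_exists:
  assumes W: "vec.subspace W"
  obtains y where "y \<in> W" and "\<And>w. w \<in> W \<Longrightarrow> cinner (x - y) w = 0"
proof -
  have spanW: "span W = W"
    using W subspace_if_vec_subspace span_eq_iff by blast
  obtain y z where y: "y \<in> W" and z: "\<And>w. w \<in> W \<Longrightarrow> orthogonal z w" and x: "x = y + z"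
    using orthogonal_subspace_decomp_exists[of W x] unfolding spanW by blast
  \<comment> \<open>Real orthogonality to \<open>W\<close> is complex orthogonality since \<open>\<i> *s W \<subseteq> W\<close>.\<close>
  have "cinner z w = 0" if "w \<in> W" for w
  proof -
    have "\<i> *s w \<in> W"
      using W that by (rule vec.subspace_scale)
    then have "Re (cinner z w) = 0" and "Re (cinner z (\<i> *s w)) = 0"
      using z that by (simp_all add: orthogonal_def Re_cinner)
    then show ?thesis
      by (simp add: cinner_scale_right complex_eq_iff)
  qed
  with y x show ?thesis
    using that by simp
qed

lemma orthogonal_decomp_unique:
  assumes W: "vec.subspace W" and "y \<in> W" and "y' \<in> W"
    and "\<And>w. w \<in> W \<Longrightarrow> cinner (x - y) w = 0" and "\<And>w. w \<in> W \<Longrightarrow> cinner (x - y') w = 0"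
  shows "y = y'"
proof -
  have "y' - y \<in> W"
    using assms by (simp add: vec.subspace_diff)
  then have "cinner ((x - y) - (x - y')) (y' - y) = 0"
    using assms by (simp add: cinner_diff_left)
  then show ?thesis
    by simp
qed

lemma orthogonal_foot_linear:
  assumes W: "vec.subspace W"
  obtains p where "Vector_Spaces.linear (*s) (*s) p"
    and "\<And>x. p x \<in> W" and "\<And>x w. w \<in> W \<Longrightarrow> cinner (x - p x) w = 0"
proof -
  define foot where "foot x y \<longleftrightarrow> y \<in> W \<and> (\<forall>w\<in>W. cinner (x - y) w = 0)" for x y
  define p where "p x = (THE y. foot x y)" for x
  have foot_ex1: "\<exists>!y. foot x y" for x
    using orthogonal_decomp_exists[OF W, of x] orthogonal_decomp_unique[OF W]
    unfolding foot_def by metis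
  have foot_p: "foot x (p x)" for x
    unfolding p_def using foot_ex1 by (rule theI')
  have p_eqI: "foot x y \<Longrightarrow> p x = y" for x y
    unfolding p_def using foot_ex1 by (rule the1_equality)
  have "Vector_Spaces.linear (*s) (*s) p"
  proof (unfold Vector_Spaces.linear_iff, intro conjI allI)
    show "p (x + y) = p x + p y" for x y
    proof (rule p_eqI)
      have split: "(x + y) - (p x + p y) = (x - p x) + (y - p y)"
        by simp
      show "foot (x + y) (p x + p y)"
        using foot_p[of x] foot_p[of y] W
        by (simp add: foot_def vec.subspace_add split cinner_add_left)
    qed
    show "p (c *s x) = c *s p x" for c x
    proof (rule p_eqI)
      show "foot (c *s x) (c *s p x)"
        using foot_p[of x] W
        by (simp add: foot_def vec.subspace_scale cinner_scale_left flip: vector_ssub_ldistrib)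
    qed
  qed (rule vec.vector_space_axioms)+
  with that show thesis
    using foot_p unfolding foot_def by blast
qed

lemma orth_proj_exists:
  assumes W: "vec.subspace W"
  shows "\<exists>P. orth_proj P \<and> range ((*v) P) = W"
proof -
  obtain p where lin: "Vector_Spaces.linear (*s) (*s) p" and pW: "\<And>x. p x \<in> W"
    and orth: "\<And>x w. w \<in> W \<Longrightarrow> cinner (x - p x) w = 0"
    using orthogonal_foot_linear[OF W] by blast
  have P: "matrix p *v x = p x" for x
    using lin by (rule matrix_works)
  have p_fix: "p w = w" if "w \<in> W" for w
    using orthogonal_decomp_unique[OF W pW that orth, of w] by simp
  have "range ((*v) (matrix p)) = W"
    using pW p_fix unfolding P by (metis image_subset_iff rangeI subsetI subset_antisym)
  moreover have "matrix p ** matrix p = matrix p"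
    using pW p_fix by (simp add: matrix_eq matrix_vector_mul_assoc[symmetric] P)
  moreover have "cadj (matrix p) = matrix p"
  proof -
    have "cinner (p x) y = cinner (p x) (p y)" for x y
    proof -
      have "cinner (p x) (y - p y) = 0"
        using orth[OF pW, of y x] by (subst cinner_commute) simp
      then show ?thesis
        by (simp add: cinner_diff_right)
    qed
    moreover have "cinner x (p y) = cinner (p x) (p y)" for x y
      using orth[OF pW, of x y] by (simp add: cinner_diff_left)
    ultimately show ?thesis
      by (simp add: cadj_eq_iff_cinner P)
  qed
  ultimately show ?thesis
    unfolding orth_proj_def by blast
qed

lemma
  assumes "vec.subspace W"
  shows orth_proj_proj_onto: "orth_proj (proj_onto W)"
    and range_proj_onto: "range ((*v) (proj_onto W)) = W"
proof -
  obtain P where P: "orth_proj P \<and> range ((*v) P) = W"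
    using orth_proj_exists[OF assms] by blast
  have "\<exists>!P. orth_proj P \<and> range ((*v) P) = W"
    by (rule ex1I[of _ P]) (use P orth_proj_unique in auto)
  then have "orth_proj (proj_onto W) \<and> range ((*v) (proj_onto W)) = W"
    unfolding proj_onto_def by (rule theI')
  then show "orth_proj (proj_onto W)" and "range ((*v) (proj_onto W)) = W"
    by simp_all
qed

lemma orth_proj_supp: "orth_proj (supp x)"
  unfolding supp_def by (rule orth_proj_proj_onto[OF vec_subspace_range])

lemma range_supp: "range ((*v) (supp x)) = range ((*v) x)"
  unfolding supp_def by (rule range_proj_onto[OF vec_subspace_range])

lemma vec_subspace_sumset:
  assumes R: "\<And>k. vec.subspace (R k)"
  shows "vec.subspace {(\<Sum>k<n. u k) | u. \<forall>k<n. u k \<in> R k}"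
  unfolding vec.subspace_def
proof (intro conjI ballI allI)
  show "0 \<in> {(\<Sum>k<n. u k) | u. \<forall>k<n. u k \<in> R k}"
    using R by (intro CollectI exI[of _ "\<lambda>_. 0"]) (simp add: vec.subspace_0)
next
  fix x y
  assume "x \<in> {(\<Sum>k<n. u k) | u. \<forall>k<n. u k \<in> R k}" "y \<in> {(\<Sum>k<n. u k) | u. \<forall>k<n. u k \<in> R k}"
  then obtain u v where "x = (\<Sum>k<n. u k)" "\<forall>k<n. u k \<in> R k" "y = (\<Sum>k<n. v k)" "\<forall>k<n. v k \<in> R k"
    by blast
  then show "x + y \<in> {(\<Sum>k<n. u k) | u. \<forall>k<n. u k \<in> R k}"
    using R by (intro CollectI exI[of _ "\<lambda>k. u k + v k"]) (simp add: sum.distrib vec.subspace_add)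
next
  fix c x assume "x \<in> {(\<Sum>k<n. u k) | u. \<forall>k<n. u k \<in> R k}"
  then obtain u where "x = (\<Sum>k<n. u k)" "\<forall>k<n. u k \<in> R k"
    by blast
  then show "c *s x \<in> {(\<Sum>k<n. u k) | u. \<forall>k<n. u k \<in> R k}"
    using R by (intro CollectI exI[of _ "\<lambda>k. c *s u k"]) (simp add: vec.scale_sum_right vec.subspace_scale)
qed

lemma orth_proj_supp_join: "orth_proj (supp_join n M)"
  unfolding supp_join_def by (rule orth_proj_proj_onto[OF vec_subspace_sumset[OF vec_subspace_range]])

section \<open>Positive semidefinite matrices and the Loewner order\<close>

lemma psdI:
  assumes "\<And>v. \<exists>r\<ge>0. qform A v = complex_of_real r"
  shows "psd A"
  unfolding psd_def
proof
  fix v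
  obtain r where "r \<ge> 0" "qform A v = complex_of_real r"
    using assms by blast
  then show "Im (qform A v) = 0 \<and> 0 \<le> Re (qform A v)"
    by simp
qed

lemma qform_diff: "qform (A - B) v = qform A v - qform B v"
  by (simp add: qform_cinner matrix_vector_mult_diff_rdistrib cinner_diff_right)

lemma qform_add: "qform A (u + v) = qform A u + cinner u (A *v v) + cinner v (A *v u) + qform A v"
  by (simp add: qform_cinner matrix_vector_right_distrib cinner_add_left cinner_add_right)

lemma qform_scale: "qform A (c *s u) = cnj c * c * qform A u"
  by (simp add: qform_cinner vec.scale cinner_scale_left cinner_scale_right)

lemma psd_cadj:
  assumes A: "psd A"
  shows "cadj A = A"
proof -
  have polar: "cinner u (A *v v) = cnj (cinner v (A *v u))" for u v
  proof -
    define a b where "a = cinner u (A *v v)" and "b = cinner v (A *v u)"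
    have "Im (qform A (u + v)) = 0" "Im (qform A u) = 0" "Im (qform A v) = 0"
      "Im (qform A (u + \<i> *s v)) = 0" "Im (qform A (\<i> *s v)) = 0"
      using A unfolding psd_def by blast+
    then have "Im a + Im b = 0" and "Re a - Re b = 0"
      unfolding qform_add a_def b_def by (simp_all add: vec.scale cinner_scale_left cinner_scale_right)
    then show ?thesis
      unfolding a_def[symmetric] b_def[symmetric] by (simp add: complex_eq_iff)
  qed
  have "cinner (A *v x) y = cinner x (A *v y)" for x y
    using polar[of y x] by (subst cinner_commute) simp
  then show ?thesis
    by (simp add: cadj_eq_iff_cinner)
qed

lemma quadratic_nonneg_imp_linear_coeff_eq_0:
  fixes a b :: real
  assumes nonneg: "\<And>t. 0 \<le> 2 * t * a + t\<^sup>2 * b" and "b \<ge> 0"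
  shows "a = 0"
proof (rule ccontr)
  assume "a \<noteq> 0"
  define t where "t = - a / (b + 1)"
  have t: "t * (b + 1) = - a"
    using \<open>b \<ge> 0\<close> by (simp add: t_def)
  have "(b + 1)\<^sup>2 * (2 * t * a + t\<^sup>2 * b) = 2 * a * (b + 1) * (t * (b + 1)) + b * (t * (b + 1))\<^sup>2"
    by (simp add: algebra_simps power2_eq_square)
  also have "\<dots> = - (a\<^sup>2 * (b + 2))"
    unfolding t by (simp add: algebra_simps power2_eq_square)
  finally have "(b + 1)\<^sup>2 * (2 * t * a + t\<^sup>2 * b) = - (a\<^sup>2 * (b + 2))" .
  moreover have "(b + 1)\<^sup>2 * (2 * t * a + t\<^sup>2 * b) \<ge> 0"
    using nonneg[of t] by simp
  moreover have "a\<^sup>2 * (b + 2) > 0"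
    using \<open>a \<noteq> 0\<close> \<open>b \<ge> 0\<close> by simp
  ultimately show False
    by linarith
qed

lemma psd_qform_eq_0_imp:
  assumes A: "psd A" and q: "qform A u = 0"
  shows "A *v u = 0"
proof -
  \<comment> \<open>Nonnegativity of the form along the real line \<open>u + t y\<close> forces \<open>y = 0\<close>.\<close>
  define y where "y = A *v u"
  have "cinner u (A *v y) = cinner y y"
    unfolding y_def by (simp add: cinner_adj psd_cadj[OF A])
  moreover have "cinner y (A *v u) = cinner y y"
    by (simp add: y_def)
  ultimately have "qform A (u + complex_of_real t *s y)
      = complex_of_real (2 * t * (norm y)\<^sup>2 + t\<^sup>2 * Re (qform A y))" for t
    using q A unfolding psd_def
    by (simp add: qform_add qform_scale vec.scale cinner_scale_left cinner_scale_right
        cinner_self complex_eq_iff power2_eq_square)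
  then have "0 \<le> 2 * t * (norm y)\<^sup>2 + t\<^sup>2 * Re (qform A y)" for t
    using A unfolding psd_def by (metis Re_complex_of_real)
  moreover have "Re (qform A y) \<ge> 0"
    using A unfolding psd_def by blast
  ultimately have "(norm y)\<^sup>2 = 0"
    by (rule quadratic_nonneg_imp_linear_coeff_eq_0)
  then show ?thesis
    by (simp add: y_def)
qed

lemma loewner_le_orth_proj_iff:
  assumes P: "orth_proj P" and Q: "orth_proj Q"
  shows "loewner_le P Q \<longleftrightarrow> range ((*v) P) \<subseteq> range ((*v) Q)"
proof
  assume le: "loewner_le P Q"
  show "range ((*v) P) \<subseteq> range ((*v) Q)"
  proof
    fix u assume u: "u \<in> range ((*v) P)"
    define z where "z = u - Q *v u"
    have "qform (Q - P) u = - cinner z z"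
      using orth_proj_pythagoras[OF Q, of u]
      by (simp add: qform_diff qform_orth_proj P Q orth_proj_fix[OF P u] z_def)
    moreover have "Re (qform (Q - P) u) \<ge> 0"
      using le unfolding loewner_le_def psd_def by blast
    ultimately have "z = 0"
      by (simp add: cinner_self)
    then show "u \<in> range ((*v) Q)"
      unfolding z_def by (metis eq_iff_diff_eq_0 rangeI)
  qed
next
  assume sub: "range ((*v) P) \<subseteq> range ((*v) Q)"
  have PQ: "P *v (Q *v v) = P *v v" for v
    using orth_proj_mult_right[OF Q P sub] by (metis matrix_vector_mul_assoc)
  show "loewner_le P Q"
    unfolding loewner_le_def
  proof (rule psdI)
    fix v
    have "qform (Q - P) v = cinner (Q *v v - P *v v) (Q *v v - P *v v)"
      using orth_proj_pythagoras[OF P, of "Q *v v"]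
      by (simp add: qform_diff qform_orth_proj P Q PQ)
    also have "\<dots> = of_real ((norm (Q *v v - P *v v))\<^sup>2)"
      by (rule cinner_self)
    finally show "\<exists>r\<ge>0. qform (Q - P) v = complex_of_real r"
      by (intro exI[of _ "(norm (Q *v v - P *v v))\<^sup>2"]) simp
  qed
qed

lemma loewner_le_supp_iff:
  assumes "orth_proj Q"
  shows "loewner_le (supp x) Q \<longleftrightarrow> range ((*v) x) \<subseteq> range ((*v) Q)"
  using loewner_le_orth_proj_iff[OF orth_proj_supp assms] by (simp add: range_supp)

section \<open>Kraus maps\<close>

definition outer :: "complex^'n \<Rightarrow> complex^'n \<Rightarrow> complex^'n^'n" where
  "outer v w = (\<chi> i j. v $ i * cnj (w $ j))"

lemma outer_mult_vec: "outer v w *v u = cinner w u *s v"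
  by (simp add: outer_def vec_eq_iff matrix_vector_mult_def cinner_def sum_distrib_left mult_ac)

lemma outer_zero_left [simp]: "outer 0 w = 0"
  by (simp add: outer_def vec_eq_iff)

lemma outer_self_eq_0_iff [simp]: "outer v v = 0 \<longleftrightarrow> v = 0"
  by (metis cinner_self_eq_0 outer_mult_vec outer_zero_left matrix_vector_mult_0 vector_mul_eq_0)

lemma psd_outer_self: "psd (outer v v)"
proof (rule psdI)
  fix w
  have "qform (outer v v) w = cnj (cinner v w) * cinner v w"
    by (simp add: qform_cinner outer_mult_vec cinner_scale_right cinner_commute[of w v])
  also have "\<dots> = of_real ((cmod (cinner v w))\<^sup>2)"
    by (metis complex_norm_square mult.commute)
  finally show "\<exists>r\<ge>0. qform (outer v v) w = complex_of_real r"
    by (intro exI[of _ "(cmod (cinner v w))\<^sup>2"]) simp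
qed

lemma range_outer_subset:
  "vec.subspace W \<Longrightarrow> v \<in> W \<Longrightarrow> range ((*v) (outer v w)) \<subseteq> W"
  by (auto simp: outer_mult_vec vec.subspace_scale)

lemma qform_sum: "qform (sum f S) w = (\<Sum>i\<in>S. qform (f i) w)"
  by (induction S rule: infinite_finite_induct)
    (simp_all add: qform_cinner matrix_vector_mult_add_rdistrib cinner_add_right)

lemma qform_sandwich: "qform (cadj B ** X ** B) w = qform X (B *v w)"
  by (simp add: qform_cinner cinner_adj matrix_vector_mul_assoc[symmetric])

lemma kraus_psd_eq_0_imp:
  assumes x: "psd x" and S: "finite S" and i: "i \<in> S"
    and zero: "(\<Sum>j\<in>S. cadj (V j) ** x ** V j) = 0"
  shows "cadj (V i) ** x = 0"
proof -
  have "x *v (V i *v w) = 0" for w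
  proof (rule psd_qform_eq_0_imp[OF x])
    have "qform (\<Sum>j\<in>S. cadj (V j) ** x ** V j) w = 0"
      by (simp add: zero qform_cinner)
    then have "(\<Sum>j\<in>S. Re (qform x (V j *v w))) = 0"
      by (simp add: qform_sum qform_sandwich flip: Re_sum)
    then have "Re (qform x (V i *v w)) = 0"
      using x S i unfolding psd_def by (simp add: sum_nonneg_eq_0_iff)
    moreover have "Im (qform x (V i *v w)) = 0"
      using x unfolding psd_def by blast
    ultimately show "qform x (V i *v w) = 0"
      by (simp add: complex_eq_iff)
  qed
  then have "x ** V i = 0"
    by (simp add: matrix_eq matrix_vector_mul_assoc[symmetric])
  then show ?thesis
    using psd_cadj[OF x] cadj_mult[of x "V i"] by simp
qed

lemma kraus_faithful_on_subspace_iff: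
  assumes W: "vec.subspace W" and S: "finite S"
  shows "(\<forall>x. psd x \<and> x \<noteq> 0 \<and> range ((*v) x) \<subseteq> W \<longrightarrow> (\<Sum>i\<in>S. cadj (V i) ** x ** V i) \<noteq> 0)
    \<longleftrightarrow> (\<forall>v\<in>W. v \<noteq> 0 \<longrightarrow> (\<exists>i\<in>S. cadj (V i) *v v \<noteq> 0))"
proof
  assume faithful: "\<forall>x. psd x \<and> x \<noteq> 0 \<and> range ((*v) x) \<subseteq> W
    \<longrightarrow> (\<Sum>i\<in>S. cadj (V i) ** x ** V i) \<noteq> 0"
  show "\<forall>v\<in>W. v \<noteq> 0 \<longrightarrow> (\<exists>i\<in>S. cadj (V i) *v v \<noteq> 0)"
  proof (intro ballI impI)
    fix v assume "v \<in> W" "v \<noteq> 0"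
    then have "psd (outer v v) \<and> outer v v \<noteq> 0 \<and> range ((*v) (outer v v)) \<subseteq> W"
      using psd_outer_self range_outer_subset[OF W] by simp
    then have "(\<Sum>i\<in>S. cadj (V i) ** outer v v ** V i) \<noteq> 0"
      using faithful by blast
    moreover have "(\<Sum>i\<in>S. cadj (V i) ** outer v v ** V i) = 0"
      if "\<forall>i\<in>S. cadj (V i) *v v = 0"
      using that by (intro sum.neutral ballI)
        (simp add: matrix_eq outer_mult_vec vec.scale flip: matrix_vector_mul_assoc)
    ultimately show "\<exists>i\<in>S. cadj (V i) *v v \<noteq> 0"
      by blast
  qed
next
  assume kernel: "\<forall>v\<in>W. v \<noteq> 0 \<longrightarrow> (\<exists>i\<in>S. cadj (V i) *v v \<noteq> 0)"
  show "\<forall>x. psd x \<and> x \<noteq> 0 \<and> range ((*v) x) \<subseteq> W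
    \<longrightarrow> (\<Sum>i\<in>S. cadj (V i) ** x ** V i) \<noteq> 0"
  proof (intro allI impI notI)
    fix x assume x: "psd x \<and> x \<noteq> 0 \<and> range ((*v) x) \<subseteq> W"
      and zero: "(\<Sum>i\<in>S. cadj (V i) ** x ** V i) = 0"
    obtain u where "x *v u \<noteq> 0"
      using x by (metis matrix_eq matrix_vector_mult_0)
    moreover have "x *v u \<in> W"
      using x by blast
    ultimately obtain i where "i \<in> S" "cadj (V i) *v (x *v u) \<noteq> 0"
      using kernel by blast
    moreover have "cadj (V i) ** x = 0"
      using kraus_psd_eq_0_imp[OF _ S \<open>i \<in> S\<close> zero] x by blast
    ultimately show False
      by (simp add: matrix_vector_mul_assoc)
  qed
qed

theorem proposition4p18:
  fixes V :: "nat \<Rightarrow> complex^'n^'n" and m :: nat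
    and T :: "complex^'n^'n \<Rightarrow> complex^'n^'n"
  assumes T_def: "\<And>X. T X = (\<Sum>i<m. cadj (V i) ** X ** V i)"
    and subunital: "loewner_le (T (mat 1)) (mat 1)"
    and finite_index: "\<exists>n\<ge>1. (T ^^ n) (defect T) = 0"
  shows "(corner_faithful T \<longleftrightarrow>
            range ((*v) (orbit_supp T)) \<inter> (\<Inter>i<m. {v. cadj (V i) *v v = 0}) = {0})
       \<and> (corner_faithful T \<longleftrightarrow>
            (\<forall>v \<in> range ((*v) (orbit_supp T)). v \<noteq> 0 \<longrightarrow> (\<exists>i<m. cadj (V i) *v v \<noteq> 0)))"
proof -
  let ?QH = "range ((*v) (orbit_supp T))"
  have Q: "orth_proj (orbit_supp T)"
    unfolding orbit_supp_def by (rule orth_proj_supp_join)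
  have "corner_faithful T \<longleftrightarrow> (\<forall>v\<in>?QH. v \<noteq> 0 \<longrightarrow> (\<exists>i\<in>{..<m}. cadj (V i) *v v \<noteq> 0))"
    using kraus_faithful_on_subspace_iff
        [OF vec_subspace_range[of "orbit_supp T"] finite_lessThan[of m], where V = V]
    unfolding corner_faithful_def loewner_le_supp_iff[OF Q] T_def[symmetric] .
  moreover have "0 \<in> ?QH"
    by (rule vec.subspace_0[OF vec_subspace_range])
  ultimately show ?thesis
    by auto
qed

end
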